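(* Let $n\ge 2$. For every domain $D\subsetneq\mathbb{R}^n$ and all $x,y\in D$, $$u_D(x,y)\ge 2\log\bigl(1+r\,c_D(x,y)\bigr),\qquad r=\min\{d(x),d(y)\}.$$ The inequality is sharp, i.e. equality is attained for some domain $D\subsetneq\mathbb{R}^n$ and some distinct points $x,y\in D$.
   Context: A domain is a nonempty open connected set. For a domain $D\subsetneq\mathbb{R}^n$ and $x\in D$, $d(x)$ denotes the Euclidean distance from $x$ to $\partial D$. The Gromov hyperbolic metric $u_D$ is $$u_D(x,y)=2\log\frac{|x-y|+\max\{d(x),d(y)\}}{\sqrt{d(x)\,d(y)}},\qquad x,y\in D.$$ The Cassinian metric is $$c_D(x,y)=\sup_{p\in\partial D}\frac{|x-y|}{|x-p|\,|y-p|},\qquad x,y\in D.$$ *)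

theory Defs
  imports "HOL-Analysis.Analysis"
begin

definition is_domain :: "(real ^ 'n) set \<Rightarrow> bool" where
  "is_domain D \<longleftrightarrow> D \<noteq> {} \<and> open D \<and> connected D"

definition bdist :: "(real ^ 'n) set \<Rightarrow> real ^ 'n \<Rightarrow> real" where
  "bdist D x = infdist x (frontier D)"

definition gromov_u :: "(real ^ 'n) set \<Rightarrow> real ^ 'n \<Rightarrow> real ^ 'n \<Rightarrow> real" where
  "gromov_u D x y =
     2 * ln ((norm (x - y) + max (bdist D x) (bdist D y)) / sqrt (bdist D x * bdist D y))"

(* For a domain D \<noteq> UNIV and x, y in D the frontier is nonempty and the family is bounded
   above by norm (x - y) / (bdist D x * bdist D y), so the real-valued supremum is genuine. *)
definition cassinian :: "(real ^ 'n) set \<Rightarrow> real ^ 'n \<Rightarrow> real ^ 'n \<Rightarrow> real" where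
  "cassinian D x y = (SUP p\<in>frontier D. norm (x - y) / (norm (x - p) * norm (y - p)))"

end

theory Submission
  imports Defs
begin

text \<open>
  Every boundary point \<open>p\<close> satisfies \<open>|x - p| \<ge> d(x)\<close> and \<open>|y - p| \<ge> d(y)\<close>, so
  the Cassinian metric is at most \<open>|x - y| / (d(x) d(y))\<close>.  Multiplying by the smaller of
  \<open>d(x)\<close> and \<open>d(y)\<close> cancels it and leaves \<open>|x - y| / M\<close>, with \<open>M\<close> the larger one; hence
  \<open>1 + r c\<close> is at most \<open>(|x - y| + M) / M\<close>.  Since \<open>sqrt (d(x) d(y)) \<le> M\<close>, replacing the
  denominator by the geometric mean only increases the fraction and gives the argument of the
  logarithm in the Gromov hyperbolic metric.

  For distinct points, equality requires \<open>d(x) = d(y)\<close> and a single boundary point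
  nearest to both \<open>x\<close> and \<open>y\<close>.
  In the punctured space the origin is the only boundary point, so any two nonzero points of equal norm
  qualify; the hypothesis on the dimension makes this space connected.
\<close>

lemma frontier_domain_nonempty:
  assumes "is_domain D" "D \<noteq> UNIV"
  shows "frontier D \<noteq> {}"
  using assms by (simp add: is_domain_def frontier_eq_empty)

lemma bdist_pos:
  assumes "is_domain D" "D \<noteq> UNIV" "x \<in> D"
  shows "bdist D x > 0"
proof -
  have "x \<notin> frontier D"
    using assms by (auto simp: is_domain_def frontier_def interior_open)
  then show ?thesis
    unfolding bdist_def
    using infdist_pos_not_in_closed[OF frontier_closed frontier_domain_nonempty[OF assms(1,2)]]
    by blast
qed

lemma bdist_le_norm:
  assumes "p \<in> frontier D"
  shows "bdist D x \<le> norm (x - p)"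
  using infdist_le[OF assms] by (simp add: bdist_def dist_norm)

lemma cassinian_quotient_le:
  assumes "is_domain D" "D \<noteq> UNIV" "x \<in> D" "y \<in> D" "p \<in> frontier D"
  shows "norm (x - y) / (norm (x - p) * norm (y - p)) \<le> norm (x - y) / (bdist D x * bdist D y)"
proof (rule divide_left_mono)
  have pos: "bdist D x > 0" "bdist D y > 0"
    using bdist_pos assms by blast+
  moreover have le: "bdist D x \<le> norm (x - p)" "bdist D y \<le> norm (y - p)"
    using bdist_le_norm assms(5) by blast+
  ultimately show "bdist D x * bdist D y \<le> norm (x - p) * norm (y - p)"
    by (intro mult_mono) auto
  have "norm (x - p) > 0" "norm (y - p) > 0"
    using pos le by linarith+
  then show "norm (x - p) * norm (y - p) * (bdist D x * bdist D y) > 0"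
    using pos by (intro mult_pos_pos)
qed simp

lemma cassinian_le:
  assumes "is_domain D" "D \<noteq> UNIV" "x \<in> D" "y \<in> D"
  shows "cassinian D x y \<le> norm (x - y) / (bdist D x * bdist D y)"
  unfolding cassinian_def
  using frontier_domain_nonempty[OF assms(1,2)] cassinian_quotient_le[OF assms]
  by (intro cSUP_least)

text \<open>
  A real supremum is at least each member of the family only if the family is bounded above.
  Nonnegativity makes the argument \<open>1 + r c\<close> of the logarithm positive, so that monotonicity
  of the logarithm applies.
\<close>

lemma cassinian_nonneg:
  assumes "is_domain D" "D \<noteq> UNIV" "x \<in> D" "y \<in> D"
  shows "cassinian D x y \<ge> 0"
proof -
  obtain p where p: "p \<in> frontier D"
    using frontier_domain_nonempty[OF assms(1,2)] by blast
  have "bdd_above ((\<lambda>p. norm (x - y) / (norm (x - p) * norm (y - p))) ` frontier D)"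
    using cassinian_quotient_le[OF assms] by (rule bdd_aboveI2)
  then show ?thesis
    unfolding cassinian_def by (rule cSUP_upper2[OF _ p]) simp
qed

lemma gromov_u_ge_cassinian:
  assumes "is_domain D" "D \<noteq> UNIV" "x \<in> D" "y \<in> D"
  shows "2 * ln (1 + min (bdist D x) (bdist D y) * cassinian D x y) \<le> gromov_u D x y"
proof -
  define a b t where "a = bdist D x" and "b = bdist D y" and "t = norm (x - y)"
  have pos: "a > 0" "b > 0" and "t \<ge> 0"
    using bdist_pos assms by (auto simp: a_def b_def t_def)
  have "min a b * cassinian D x y \<le> min a b * (t / (a * b))"
    using cassinian_le[OF assms] pos by (intro mult_left_mono) (auto simp: a_def b_def t_def)
  also have "\<dots> = t / max a b"
    using pos by (auto simp: min_def max_def field_simps)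
  also have "\<dots> = (t + max a b) / max a b - 1"
    using pos by (auto simp: max_def field_simps)
  finally have "1 + min a b * cassinian D x y \<le> (t + max a b) / max a b"
    by simp
  also have "\<dots> \<le> (t + max a b) / sqrt (a * b)"
  proof (rule divide_left_mono)
    have "a * b \<le> max a b * max a b"
      using pos by (intro mult_mono) auto
    then show "sqrt (a * b) \<le> max a b"
      using pos by (intro real_le_lsqrt) (auto simp: power2_eq_square)
  qed (use pos \<open>t \<ge> 0\<close> in auto)
  finally have "1 + min a b * cassinian D x y \<le> (t + max a b) / sqrt (a * b)" .
  moreover have "0 < 1 + min a b * cassinian D x y"
    using cassinian_nonneg[OF assms] pos by (intro add_pos_nonneg mult_nonneg_nonneg) auto
  ultimately show ?thesis
    unfolding gromov_u_def a_def b_def t_def by simp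
qed

lemma frontier_punctured:
  "frontier (- {0 :: real ^ 'n::finite}) = {0}"
  unfolding frontier_complement by (simp add: frontier_def)

lemma is_domain_punctured:
  assumes "CARD('n::finite) \<ge> 2"
  shows "is_domain (- {0 :: real ^ 'n})"
proof -
  have "axis undefined 1 \<in> - {0 :: real ^ 'n}"
    by (simp add: axis_eq_0_iff)
  then show ?thesis
    using connected_punctured_universe[where 'N = "real ^ 'n"] assms
    unfolding is_domain_def by auto
qed

text \<open>
  For antipodal unit vectors both sides are \<open>2 * ln 3\<close>: the distances to the boundary are \<open>1\<close>,
  and the Cassinian distance is \<open>|e - (-e)| = 2\<close>.
\<close>

lemma gromov_u_eq_cassinian_punctured:
  fixes e :: "real ^ 'n::finite"
  assumes "norm e = 1"
  defines "D \<equiv> - {0}"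
  shows "gromov_u D e (- e) = 2 * ln (1 + min (bdist D e) (bdist D (- e)) * cassinian D e (- e))"
proof -
  have "norm (e - - e) = 2"
    using assms(1) by (simp flip: scaleR_2)
  moreover have "bdist D e = 1" "bdist D (- e) = 1"
    using assms(1) unfolding bdist_def D_def frontier_punctured by simp_all
  ultimately show ?thesis
    using assms(1) unfolding gromov_u_def cassinian_def D_def frontier_punctured by simp
qed

theorem theorem5p8:
  assumes "CARD('n::finite) \<ge> 2"
  shows "(\<forall>(D :: (real ^ 'n) set) x y.
            is_domain D \<longrightarrow> D \<noteq> UNIV \<longrightarrow> x \<in> D \<longrightarrow> y \<in> D \<longrightarrow>
            gromov_u D x y \<ge> 2 * ln (1 + min (bdist D x) (bdist D y) * cassinian D x y))
       \<and> (\<exists>(D :: (real ^ 'n) set) x y.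
            is_domain D \<and> D \<noteq> UNIV \<and> x \<in> D \<and> y \<in> D \<and> x \<noteq> y \<and>
            gromov_u D x y = 2 * ln (1 + min (bdist D x) (bdist D y) * cassinian D x y))"
proof (intro conjI allI impI)
  fix D :: "(real ^ 'n) set" and x y
  assume "is_domain D" "D \<noteq> UNIV" "x \<in> D" "y \<in> D"
  then show "gromov_u D x y \<ge> 2 * ln (1 + min (bdist D x) (bdist D y) * cassinian D x y)"
    by (rule gromov_u_ge_cassinian)
next
  obtain e :: "real ^ 'n" where e: "norm e = 1"
    using vector_choose_size[of 1] by auto
  then have "e \<noteq> 0"
    by auto
  then have "- {0} \<noteq> (UNIV :: (real ^ 'n) set)" "e \<in> - {0}" "- e \<in> - {0}" "e \<noteq> - e"
    by (auto simp: eq_neg_iff_add_eq_0 simp flip: scaleR_2)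
  with is_domain_punctured[OF assms] gromov_u_eq_cassinian_punctured[OF e]
  show "\<exists>(D :: (real ^ 'n) set) x y.
            is_domain D \<and> D \<noteq> UNIV \<and> x \<in> D \<and> y \<in> D \<and> x \<noteq> y \<and>
            gromov_u D x y = 2 * ln (1 + min (bdist D x) (bdist D y) * cassinian D x y)"
    by blast
qed

end
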